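(* Let $\alpha>0$ and $p>1$. Given $F\in C^2(\mathbb{R}^+)$, we have in $\mathbb{R}^N\setminus\{0\}$ $$\mathscr L_{\alpha,p}(F\circ \rho) = (p-1)\, |F'(\rho)|^{p-2} \left\{F''(\rho) + \frac{Q-1}{p-1}\,\frac{F'(\rho)}{\rho}\right\}\left(\frac{\Phi^0(z)}{\rho}\right)^{\alpha p}.$$ In particular, the function $$u = \begin{cases}\rho^{-\frac{Q-p}{p-1}}, & p\neq Q,\\ \log \rho, & p=Q,\end{cases}$$ is a solution of $\mathscr L_{\alpha,p}(u)=0$ in $\mathbb{R}^N\setminus\{0\}$.
   Context: Here $\mathbb{R}^+=(0,\infty)$. A Minkowski norm on $\mathbb{R}^n$ is a function $M:\mathbb{R}^n\to[0,\infty)$ such that $M^2\in C^2(\mathbb{R}^n\setminus\{0\})$ is strictly convex and $M(\lambda x)=|\lambda|M(x)$ for all $x\in\mathbb{R}^n$, $\lambda\in\mathbb{R}$. Its Legendre transform (dual norm) is $M^0(x)=\sup_{M(\xi)=1}\langle x,\xi\rangle$. Let $m,k\ge 1$, $N=m+k$, $\mathbb{R}^N=\mathbb{R}^m\times\mathbb{R}^k$ with points $(z,\sigma)$, $z\in\mathbb{R}^m$, $\sigma\in\mathbb{R}^k$. Let $\Phi\in C^2(\mathbb{R}^m\setminus\{0\})$ and $\Psi\in C^2(\mathbb{R}^k\setminus\{0\})$ be strictly convex Minkowski norms on $\mathbb{R}^m$ and $\mathbb{R}^k$, with dual norms $\Phi^0(z)=\sup_{\Phi(\zeta)=1}\langle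 z,\zeta\rangle$ and $\Psi^0(\sigma)=\sup_{\Psi(\eta)=1}\langle\sigma,\eta\rangle$. Set $Q=m+(\alpha+1)k$ and $$\rho(z,\sigma)=\Theta^0(z,\sigma)=\left(\Phi^0(z)^{2(\alpha+1)}+4(\alpha+1)^2\Psi^0(\sigma)^2\right)^{\frac{1}{2(\alpha+1)}}.$$ The operator $\mathscr L_{\alpha,p}$ is $$\mathscr L_{\alpha,p}(u)=\operatorname{div}_{(z,\sigma)}\left(\left(\Phi(\nabla_z u)^2+\frac{\Phi^0(z)^{2\alpha}}{4}\Psi(\nabla_\sigma u)^2\right)^{\frac{p-2}{2}}\mathscr A(\nabla_{(z,\sigma)}u)\right),$$ $$\mathscr A(\nabla_{(z,\sigma)}u)=\begin{pmatrix}\Phi(\nabla_z u)\,\nabla\Phi(\nabla_z u)\\[2pt] \frac{\Phi^0(z)^{2\alpha}}{4}\,\Psi(\nabla_\sigma u)\,\nabla\Psi(\nabla_\sigma u)\end{pmatrix},$$ where $\nabla_z,\nabla_\sigma$ are the Euclidean gradients in $z$ and $\sigma$.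
   Formalization: For 1<p<2 the formula is asserted only at points where F'(ρ)≠0, since |F'(ρ)|^{p-2} is otherwise a negative power of zero and undefined (e.g. p=3/2, F(r)=(r−1)², ρ=1); for p=2 the factor |F'(ρ)|^{p-2} is read as 1. *)

theory Defs
  imports "HOL-Analysis.Analysis"
begin

definition C2_on :: "'a::euclidean_space set \<Rightarrow> ('a \<Rightarrow> real) \<Rightarrow> bool" where
  "C2_on S f \<longleftrightarrow>
     (\<exists>(f' :: 'a \<Rightarrow> 'a \<Rightarrow>\<^sub>L real) (f'' :: 'a \<Rightarrow> 'a \<Rightarrow>\<^sub>L ('a \<Rightarrow>\<^sub>L real)).
        (\<forall>x\<in>S. (f has_derivative blinfun_apply (f' x)) (at x)) \<and>
        (\<forall>x\<in>S. (f' has_derivative blinfun_apply (f'' x)) (at x)) \<and>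
        continuous_on S f'')"

definition strictly_convex_on :: "'a::real_vector set \<Rightarrow> ('a \<Rightarrow> real) \<Rightarrow> bool" where
  "strictly_convex_on S f \<longleftrightarrow> convex S \<and>
     (\<forall>x\<in>S. \<forall>y\<in>S. \<forall>t. x \<noteq> y \<and> 0 < t \<and> t < 1 \<longrightarrow>
        f ((1 - t) *\<^sub>R x + t *\<^sub>R y) < (1 - t) * f x + t * f y)"

definition minkowski_norm :: "('a::euclidean_space \<Rightarrow> real) \<Rightarrow> bool" where
  "minkowski_norm M \<longleftrightarrow>
     (\<forall>x. 0 \<le> M x) \<and>
     C2_on (UNIV - {0}) (\<lambda>x. (M x)\<^sup>2) \<and>
     strictly_convex_on UNIV (\<lambda>x. (M x)\<^sup>2) \<and>
     (\<forall>x c. M (c *\<^sub>R x) = \<bar>c\<bar> * M x)"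

definition dual_norm :: "('a::euclidean_space \<Rightarrow> real) \<Rightarrow> 'a \<Rightarrow> real" where
  "dual_norm M x = (SUP \<xi>\<in>{\<xi>. M \<xi> = 1}. x \<bullet> \<xi>)"

text \<open>Real powers of nonnegative numbers with the convention that the zeroth power of 0 is 1;
  the library function \<^const>\<open>powr\<close> gives 0 there, which would be wrong for
  the factors with exponent \<open>p - 2\<close> and \<open>(p - 2) / 2\<close> when \<open>p = 2\<close>. A negative power of 0 gets the value 0; in the flux
  it only ever multiplies a zero vector.\<close>

definition rpow :: "real \<Rightarrow> real \<Rightarrow> real" where
  "rpow x a = (if a = 0 then 1 else x powr a)"

text \<open>The gradient is an unspecified vector where \<open>f\<close> is not differentiable. In the flux below,
  for differentiable \<open>u\<close>, this can happen only for the gradient of a Minkowski norm \<open>M\<close> at the origin, where it is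
  multiplied by \<open>M 0 = 0\<close>.\<close>

definition grad :: "('a::euclidean_space \<Rightarrow> real) \<Rightarrow> 'a \<Rightarrow> 'a" where
  "grad f x = (THE D. GDERIV f x :> D)"

text \<open>The divergence is the sum of the diagonal partial derivatives; only these are required
  to exist. The flux need not be Frechet differentiable at points with \<open>z = 0\<close>.\<close>

definition has_div_at :: "('a::euclidean_space \<Rightarrow> 'a) \<Rightarrow> 'a \<Rightarrow> bool" where
  "has_div_at V x \<longleftrightarrow>
     (\<forall>i\<in>Basis. (\<lambda>t::real. V (x + t *\<^sub>R i) \<bullet> i) differentiable (at 0))"

definition diverg :: "('a::euclidean_space \<Rightarrow> 'a) \<Rightarrow> 'a \<Rightarrow> real" where
  "diverg V x = (\<Sum>i\<in>Basis. deriv (\<lambda>t::real. V (x + t *\<^sub>R i) \<bullet> i) 0)"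

definition L_flux ::
  "real \<Rightarrow> real \<Rightarrow> ('a::euclidean_space \<Rightarrow> real) \<Rightarrow> ('b::euclidean_space \<Rightarrow> real)
    \<Rightarrow> ('a \<times> 'b \<Rightarrow> real) \<Rightarrow> 'a \<times> 'b \<Rightarrow> 'a \<times> 'b" where
  "L_flux \<alpha> p \<Phi> \<Psi> u = (\<lambda>(z, \<sigma>).
     let gz = grad (\<lambda>z'. u (z', \<sigma>)) z;
         gs = grad (\<lambda>\<sigma>'. u (z, \<sigma>')) \<sigma>;
         w = dual_norm \<Phi> z powr (2 * \<alpha>) / 4
     in rpow ((\<Phi> gz)\<^sup>2 + w * (\<Psi> gs)\<^sup>2) ((p - 2) / 2) *\<^sub>R
          (\<Phi> gz *\<^sub>R grad \<Phi> gz, (w * \<Psi> gs) *\<^sub>R grad \<Psi> gs))"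

definition L_op ::
  "real \<Rightarrow> real \<Rightarrow> ('a::euclidean_space \<Rightarrow> real) \<Rightarrow> ('b::euclidean_space \<Rightarrow> real)
    \<Rightarrow> ('a \<times> 'b \<Rightarrow> real) \<Rightarrow> 'a \<times> 'b \<Rightarrow> real" where
  "L_op \<alpha> p \<Phi> \<Psi> u = diverg (L_flux \<alpha> p \<Phi> \<Psi> u)"

text \<open>All derivatives entering \<^const>\<open>L_op\<close> exist in the classical sense at \<open>x\<close>.\<close>

definition L_defined_at ::
  "real \<Rightarrow> real \<Rightarrow> ('a::euclidean_space \<Rightarrow> real) \<Rightarrow> ('b::euclidean_space \<Rightarrow> real)
    \<Rightarrow> ('a \<times> 'b \<Rightarrow> real) \<Rightarrow> 'a \<times> 'b \<Rightarrow> bool" where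
  "L_defined_at \<alpha> p \<Phi> \<Psi> u x \<longleftrightarrow>
     (\<forall>\<^sub>F y in nhds x. u differentiable (at y)) \<and> has_div_at (L_flux \<alpha> p \<Phi> \<Psi> u) x"

definition rho ::
  "real \<Rightarrow> ('a::euclidean_space \<Rightarrow> real) \<Rightarrow> ('b::euclidean_space \<Rightarrow> real) \<Rightarrow> 'a \<times> 'b \<Rightarrow> real" where
  "rho \<alpha> \<Phi> \<Psi> = (\<lambda>(z, \<sigma>).
     (dual_norm \<Phi> z powr (2 * (\<alpha> + 1)) + 4 * (\<alpha> + 1)\<^sup>2 * (dual_norm \<Psi> \<sigma>)\<^sup>2)
       powr (1 / (2 * (\<alpha> + 1))))"

end

theory Submission
  imports Defs
begin

text \<open>
  The whole computation rests on duality. Where the dual norm \<open>M\<^sup>0\<close> of a Minkowski norm \<open>M\<close> is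
  differentiable, its gradient is the maximiser \<open>\<xi>\<close> in the supremum defining \<open>M\<^sup>0 x\<close>, so that
  \<open>M (\<nabla>M\<^sup>0(x)) = 1\<close>; and because \<open>\<langle>x, \<cdot>\<rangle> \<le> M\<^sup>0(x) M\<close> with equality at \<open>\<xi>\<close>, the gradient of \<open>M\<close> at
  \<open>\<xi>\<close> is \<open>x / M\<^sup>0(x)\<close>. Strict convexity makes the maximiser unique, and compactness of the unit
  sphere makes it depend continuously on \<open>x\<close>; hence \<open>M\<^sup>0\<close> is \<open>C\<^sup>1\<close> off the origin. It need not be
  \<open>C\<^sup>2\<close>, as the Hessian of \<open>M\<^sup>2\<close> may degenerate, so the divergence cannot be expanded into second
  derivatives of \<open>\<rho>\<close>.

  This is no obstacle, because the nonlinearity of the operator undoes that of \<open>\<rho>\<close>. Inserting the two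
  identities, the flux of \<open>F \<circ> \<rho>\<close> collapses to
  \<open>|F'(\<rho>)|\<^bsup>p-2\<^esup> F'(\<rho>) \<rho>\<^bsup>-\<alpha>p-1\<^esup> \<Phi>\<^sup>0(z)\<^bsup>\<alpha>p\<^esup> X\<close> with the linear vector field \<open>X(z,\<sigma>) = (z, (\<alpha>+1)\<sigma>)\<close>
  (lemma \<open>flux_of_radial_function\<close>), which contains no derivatives of the dual norms.

  The field \<open>X\<close> generates the dilations \<open>(z,\<sigma>) \<mapsto> (\<lambda>z, \<lambda>\<^bsup>\<alpha>+1\<^esup>\<sigma>)\<close>, under which \<open>\<rho>\<close> and \<open>\<Phi>\<^sup>0\<close> are
  homogeneous of degree one. So Euler's identities give \<open>X\<rho> = \<rho>\<close> and \<open>X\<Phi>\<^sup>0 = \<Phi>\<^sup>0\<close>, while \<open>div X = Q\<close>. The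
  product rule then turns the divergence into the stated expression (lemma \<open>L_of_radial_function\<close>). On
  the set \<open>z = 0\<close> the factor \<open>\<Phi>\<^sup>0(z)\<^bsup>\<alpha>p\<^esup>\<close> may fail to be differentiable, but there the flux vanishes and
  the components in the \<open>z\<close>-directions carry the further factor \<open>z\<close>, so that every diagonal partial
  derivative exists and is zero.

  The fundamental solution comes from a nonconstant solution of
  \<open>F''(r) + (Q-1)/(p-1) F'(r)/r = 0\<close>; its derivative \<open>F'\<close> has no zero, so the formula applies for
  every \<open>p\<close>.
\<close>

section \<open>Gradients and the dual norm\<close>

lemma GDERIV_unique:
  assumes "GDERIV f x :> D" "GDERIV f x :> E"
  shows "D = E"
proof -
  have "(\<lambda>h. h \<bullet> D) = (\<lambda>h. h \<bullet> E)"
    using assms unfolding gderiv_def by (rule has_derivative_unique)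
  then have "(D - E) \<bullet> D = (D - E) \<bullet> E"
    by metis
  then have "(D - E) \<bullet> (D - E) = 0"
    by (simp add: inner_diff_right)
  then show ?thesis by simp
qed

lemma grad_eqI: "GDERIV f x :> D \<Longrightarrow> grad f x = D"
  unfolding grad_def by (blast intro: GDERIV_unique)

text \<open>The point of the unit sphere of \<open>M\<close> at which \<open>\<langle>x, \<cdot>\<rangle>\<close> attains its supremum. For \<open>x \<noteq> 0\<close> it is unique
  and equals the gradient of the dual norm. At \<open>x = 0\<close> it is an arbitrary unit vector; having one there
  allows gradients such as that of \<open>(M\<^sup>0)\<^sup>q\<close> to be written uniformly, with a coefficient that vanishes.\<close>
definition polar :: "('a::euclidean_space \<Rightarrow> real) \<Rightarrow> 'a \<Rightarrow> 'a" where
  "polar M x = (SOME \<xi>. M \<xi> = 1 \<and> x \<bullet> \<xi> = dual_norm M x)"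

context
  fixes M :: "'a::euclidean_space \<Rightarrow> real"
  assumes mink: "minkowski_norm M"
begin

lemma minkowski_nonneg: "0 \<le> M x"
  using mink by (simp add: minkowski_norm_def)

lemma minkowski_scale: "M (c *\<^sub>R x) = \<bar>c\<bar> * M x"
  using mink by (simp add: minkowski_norm_def)

lemma minkowski_zero: "M 0 = 0"
  using minkowski_scale[of 0 0] by simp

lemma minkowski_sq_strictly_convex:
  assumes "x \<noteq> y" "0 < t" "t < 1"
  shows "(M ((1 - t) *\<^sub>R x + t *\<^sub>R y))\<^sup>2 < (1 - t) * (M x)\<^sup>2 + t * (M y)\<^sup>2"
proof -
  have "strictly_convex_on UNIV (\<lambda>x. (M x)\<^sup>2)"
    using mink by (simp add: minkowski_norm_def)
  then show ?thesis
    using assms by (simp add: strictly_convex_on_def)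
qed

lemma minkowski_sq_midpoint:
  assumes "x \<noteq> y"
  shows "(M ((1/2) *\<^sub>R (x + y)))\<^sup>2 < ((M x)\<^sup>2 + (M y)\<^sup>2) / 2"
  using minkowski_sq_strictly_convex[OF assms, of "1/2"]
  by (simp add: scaleR_add_right add_divide_distrib)

text \<open>A zero \<open>x \<noteq> 0\<close> of \<open>M\<close> would make \<open>M\<^sup>2\<close> vanish on the whole segment from \<open>0\<close> to \<open>x\<close>, against strict
  convexity.\<close>
lemma minkowski_pos:
  assumes "x \<noteq> 0" shows "0 < M x"
proof -
  have "(M x)\<^sup>2 / 4 < (M x)\<^sup>2 / 2"
    using minkowski_sq_midpoint[OF assms] by (simp add: minkowski_scale minkowski_zero power_mult_distrib power2_eq_square)
  then have "M x \<noteq> 0" by auto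
  with minkowski_nonneg[of x] show ?thesis by linarith
qed

text \<open>A finite convex function on the whole space is continuous; applied to \<open>M\<^sup>2\<close> this covers the origin,
  where no smoothness is assumed.\<close>
lemma minkowski_continuous: "continuous_on UNIV M"
proof -
  have "convex_on UNIV (\<lambda>x. (M x)\<^sup>2)"
  proof (rule convex_onI)
    fix t :: real and x y :: 'a
    assume "0 < t" "t < 1"
    then show "(M ((1 - t) *\<^sub>R x + t *\<^sub>R y))\<^sup>2 \<le> (1 - t) * (M x)\<^sup>2 + t * (M y)\<^sup>2"
      using minkowski_sq_strictly_convex[of x y t]
      by (cases "x = y") (auto simp: scaleR_left_distrib[symmetric] algebra_simps less_imp_le)
  qed simp
  then have "continuous_on UNIV (\<lambda>x. sqrt ((M x)\<^sup>2))"
    by (intro continuous_intros convex_on_continuous) auto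
  then show ?thesis
    by (simp add: minkowski_nonneg)
qed

lemma minkowski_differentiable:
  assumes "x \<noteq> 0"
  obtains D where "GDERIV M x :> D"
proof -
  have "C2_on (UNIV - {0}) (\<lambda>x. (M x)\<^sup>2)"
    using mink by (simp add: minkowski_norm_def)
  then obtain f' :: "'a \<Rightarrow> 'a \<Rightarrow>\<^sub>L real" where "((\<lambda>x. (M x)\<^sup>2) has_derivative f' x) (at x)"
    using assms unfolding C2_on_def by auto
  then have "((\<lambda>x. sqrt ((M x)\<^sup>2)) has_derivative (\<lambda>h. f' x h * (inverse (sqrt ((M x)\<^sup>2)) / 2))) (at x)"
    using minkowski_pos[OF assms] by (intro has_derivative_real_sqrt) auto
  then have der: "(M has_derivative (\<lambda>h. f' x h * (inverse (M x) / 2))) (at x)" (is "(M has_derivative ?g) _")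
    by (simp add: minkowski_nonneg)
  \<comment> \<open>The adjoint of a linear functional, applied to \<open>1\<close>, is the vector representing it.\<close>
  define D where "D = adjoint ?g 1"
  have "?g h = h \<bullet> D" for h
    using adjoint_works[OF has_derivative_linear[OF der], of h 1] by (simp add: D_def)
  with der have "GDERIV M x :> D"
    by (simp add: gderiv_def)
  then show ?thesis by (rule that)
qed

text \<open>The minimum of \<open>M\<close> on the Euclidean sphere is positive, so homogeneity bounds the unit sphere of
  \<open>M\<close>.\<close>
lemma minkowski_unit_sphere_compact: "compact {\<xi>. M \<xi> = 1}"
proof -
  have cont: "continuous_on S M" for S
    using minkowski_continuous continuous_on_subset by blast
  have ne: "sphere (0::'a) 1 \<noteq> {}"
    by simp
  obtain s where s: "s \<in> sphere 0 1" and min: "\<And>y. y \<in> sphere 0 1 \<Longrightarrow> M s \<le> M y"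
    using continuous_attains_inf[OF compact_sphere ne cont] by blast
  have "0 < M s" using s by (intro minkowski_pos) auto
  have "norm \<xi> \<le> 1 / M s" if "M \<xi> = 1" for \<xi>
  proof -
    have "\<xi> \<noteq> 0" using that minkowski_zero by auto
    then have "M s \<le> M ((1 / norm \<xi>) *\<^sub>R \<xi>)" by (intro min) simp
    then show ?thesis
      using \<open>0 < M s\<close> \<open>\<xi> \<noteq> 0\<close> that by (simp add: minkowski_scale field_simps)
  qed
  then have "bounded {\<xi>. M \<xi> = 1}"
    unfolding bounded_iff by blast
  moreover have "closed {\<xi>. M \<xi> = 1}"
    using minkowski_continuous by (intro closed_Collect_eq) auto
  ultimately show ?thesis by (simp add: compact_eq_bounded_closed)
qed

lemma dual_norm_attained:
  obtains \<xi> where "M \<xi> = 1" "x \<bullet> \<xi> = dual_norm M x" "\<And>\<eta>. M \<eta> = 1 \<Longrightarrow> x \<bullet> \<eta> \<le> dual_norm M x"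
proof -
  obtain b :: 'a where "b \<in> Basis" using nonempty_Basis by blast
  then have "b \<noteq> 0" by (rule nonzero_Basis)
  then have "M ((1 / M b) *\<^sub>R b) = 1"
    using minkowski_pos[of b] by (simp add: minkowski_scale)
  then have ne: "{\<xi>. M \<xi> = 1} \<noteq> {}" by blast
  have "continuous_on {\<xi>. M \<xi> = 1} (\<lambda>\<xi>. x \<bullet> \<xi>)"
    by (intro continuous_intros)
  then obtain \<xi> where \<xi>: "M \<xi> = 1" "\<And>\<eta>. M \<eta> = 1 \<Longrightarrow> x \<bullet> \<eta> \<le> x \<bullet> \<xi>"
    using continuous_attains_sup[OF minkowski_unit_sphere_compact ne] by blast
  then have "dual_norm M x = x \<bullet> \<xi>"
    unfolding dual_norm_def by (intro cSup_eq_maximum) auto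
  with \<xi> show ?thesis by (intro that[of \<xi>]) auto
qed

lemma polar_unit: "M (polar M x) = 1"
  and polar_attains: "x \<bullet> polar M x = dual_norm M x"
proof -
  have "\<exists>\<xi>. M \<xi> = 1 \<and> x \<bullet> \<xi> = dual_norm M x"
    using dual_norm_attained by metis
  then have "M (polar M x) = 1 \<and> x \<bullet> polar M x = dual_norm M x"
    unfolding polar_def by (rule someI_ex)
  then show "M (polar M x) = 1" "x \<bullet> polar M x = dual_norm M x" by auto
qed

lemma inner_le_dual_norm: "x \<bullet> \<xi> \<le> dual_norm M x * M \<xi>"
proof (cases "\<xi> = 0")
  case False
  then have pos: "0 < M \<xi>" by (rule minkowski_pos)
  then have "M ((1 / M \<xi>) *\<^sub>R \<xi>) = 1" by (simp add: minkowski_scale)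
  then have "x \<bullet> ((1 / M \<xi>) *\<^sub>R \<xi>) \<le> dual_norm M x"
    using dual_norm_attained[of x] by metis
  then show ?thesis using pos by (simp add: field_simps)
qed (simp add: minkowski_zero)

lemma dual_norm_zero: "dual_norm M 0 = 0"
  using polar_attains[of 0] by simp

lemma dual_norm_pos:
  assumes "x \<noteq> 0" shows "0 < dual_norm M x"
proof -
  have "0 < x \<bullet> x" using assms by simp
  also have "\<dots> \<le> dual_norm M x * M x" by (rule inner_le_dual_norm)
  finally show ?thesis
    using minkowski_pos[OF assms] by (simp add: zero_less_mult_iff)
qed

lemma dual_norm_nonneg: "0 \<le> dual_norm M x"
  using dual_norm_pos[of x] dual_norm_zero by (cases "x = 0") auto

text \<open>The midpoint of two distinct maximisers has \<open>M < 1\<close> but the same value of \<open>\<langle>x, \<cdot>\<rangle>\<close>, which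
  contradicts the duality inequality.\<close>
lemma polar_eqI:
  assumes "x \<noteq> 0" "M \<xi> = 1" "x \<bullet> \<xi> = dual_norm M x"
  shows "polar M x = \<xi>"
proof (rule ccontr)
  assume ne: "polar M x \<noteq> \<xi>"
  define \<mu> where "\<mu> = (1/2) *\<^sub>R (polar M x + \<xi>)"
  have "(M \<mu>)\<^sup>2 < 1\<^sup>2"
    using minkowski_sq_midpoint[OF ne] assms(2) by (simp add: \<mu>_def polar_unit)
  then have "M \<mu> < 1"
    using power2_less_imp_less zero_le_one by blast
  moreover have "x \<bullet> \<mu> = dual_norm M x"
    using assms(3) by (simp add: \<mu>_def inner_add_right polar_attains)
  ultimately show False
    using inner_le_dual_norm[of x \<mu>] dual_norm_pos[OF assms(1)] by simp
qed

lemma polar_bounded: obtains B where "0 \<le> B" "\<And>x. norm (polar M x) \<le> B"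
proof -
  obtain B where "\<And>\<xi>. M \<xi> = 1 \<Longrightarrow> norm \<xi> \<le> B"
    using compact_imp_bounded[OF minkowski_unit_sphere_compact] unfolding bounded_iff by auto
  then have *: "\<And>x. norm (polar M x) \<le> B" using polar_unit by blast
  moreover have "0 \<le> B" using *[of 0] norm_ge_zero order_trans by blast
  ultimately show ?thesis using that by blast
qed

text \<open>As a supremum of linear functions the dual norm is convex, with subgradient \<open>polar M x\<close> at \<open>x\<close>. The
  two subgradient inequalities at \<open>x\<close> and \<open>y\<close> yield both its Lipschitz continuity and its
  differentiability.\<close>
lemma dual_norm_diff_bounds:
  "(y - x) \<bullet> polar M x \<le> dual_norm M y - dual_norm M x"
  "dual_norm M y - dual_norm M x \<le> (y - x) \<bullet> polar M y"
  using inner_le_dual_norm[of y "polar M x"] inner_le_dual_norm[of x "polar M y"]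
  by (simp_all add: polar_unit inner_diff_left polar_attains)

lemma dual_norm_lipschitz:
  obtains B where "0 \<le> B" "\<And>x y. \<bar>dual_norm M y - dual_norm M x\<bar> \<le> B * norm (y - x)"
proof -
  obtain B where B: "0 \<le> B" "\<And>x. norm (polar M x) \<le> B" using polar_bounded by blast
  have le: "dual_norm M y - dual_norm M x \<le> B * norm (y - x)" for x y
  proof -
    have "dual_norm M y - dual_norm M x \<le> norm (y - x) * norm (polar M y)"
      using dual_norm_diff_bounds(2) norm_cauchy_schwarz order_trans by blast
    also have "\<dots> \<le> B * norm (y - x)"
      by (simp add: B(2) mult_right_mono mult.commute[of "norm (y - x)"])
    finally show ?thesis .
  qed
  have "\<bar>dual_norm M y - dual_norm M x\<bar> \<le> B * norm (y - x)" for x y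
    using le[of y x] le[of x y] by (simp add: norm_minus_commute abs_le_iff)
  with B(1) show ?thesis by (rule that)
qed

lemma dual_norm_continuous: "continuous_on UNIV (dual_norm M)"
proof -
  obtain B where "0 \<le> B" "\<And>x y. \<bar>dual_norm M y - dual_norm M x\<bar> \<le> B * norm (y - x)"
    by (rule dual_norm_lipschitz) blast
  then have "B-lipschitz_on UNIV (dual_norm M)"
    by (intro lipschitz_onI) (simp_all add: dist_norm norm_minus_commute)
  then show ?thesis by (rule lipschitz_on_continuous_on)
qed

lemma isCont_dual_norm: "isCont (dual_norm M) x"
  using dual_norm_continuous by (simp add: continuous_on_eq_continuous_at)

text \<open>By uniqueness of the maximiser, the graph of \<open>polar M\<close> over a closed ball avoiding the origin is cut
  out by the closed conditions \<open>M \<xi> = 1\<close> and \<open>y \<bullet> \<xi> = dual_norm M y\<close>. A map into a compact set with closed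
  graph is continuous.\<close>
lemma isCont_polar:
  assumes "x \<noteq> 0"
  shows "isCont (polar M) x"
proof -
  define S where "S = cball x (norm x / 2)"
  let ?K = "{\<xi>. M \<xi> = 1}"
  have S0: "y \<noteq> 0" if "y \<in> S" for y
    using that assms by (auto simp: S_def dist_norm)
  have graph: "(\<lambda>y. (y, polar M y)) ` S = {w. fst w \<in> S \<and> snd w \<in> ?K \<and> fst w \<bullet> snd w = dual_norm M (fst w)}"
    using S0 polar_eqI by (force simp: polar_unit polar_attains image_iff)
  have "closed {w::'a \<times> 'a. fst w \<in> S}" "closed {w::'a \<times> 'a. snd w \<in> ?K}"
    using closed_vimage_fst[of S] closed_vimage_snd[OF compact_imp_closed[OF minkowski_unit_sphere_compact]]
    by (simp_all add: S_def vimage_def)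
  moreover have "closed {w::'a \<times> 'a. fst w \<bullet> snd w = dual_norm M (fst w)}"
    by (intro closed_Collect_eq continuous_intros continuous_on_compose2[OF dual_norm_continuous]) auto
  ultimately have "closed ((\<lambda>y. (y, polar M y)) ` S)"
    unfolding graph by (intro closed_Collect_conj)
  then have "continuous_on S (polar M)"
    using minkowski_unit_sphere_compact by (intro continuous_from_closed_graph) (auto simp: polar_unit)
  then have "continuous_on (ball x (norm x / 2)) (polar M)"
    by (rule continuous_on_subset) (auto simp: S_def)
  then show ?thesis
    using assms by (simp add: continuous_on_eq_continuous_at)
qed

text \<open>The subgradient inequalities squeeze the first-order remainder between \<open>0\<close> and
  \<open>\<langle>y - x, polar M y - polar M x\<rangle>\<close>, which is \<open>o(|y - x|)\<close> by continuity of the maximiser.\<close>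
lemma GDERIV_dual_norm:
  assumes "x \<noteq> 0"
  shows "GDERIV (dual_norm M) x :> polar M x"
  unfolding gderiv_def has_derivative_at_within
proof (safe)
  show "bounded_linear (\<lambda>h. h \<bullet> polar M x)" by (rule bounded_linear_inner_left)
  let ?e = "\<lambda>y. ((dual_norm M y - dual_norm M x) - (y - x) \<bullet> polar M x) /\<^sub>R norm (y - x)"
  have bound: "norm (?e y) \<le> norm (polar M y - polar M x)" for y
  proof -
    have "\<bar>(dual_norm M y - dual_norm M x) - (y - x) \<bullet> polar M x\<bar> \<le> (y - x) \<bullet> (polar M y - polar M x)"
      using dual_norm_diff_bounds[of y x] by (simp add: inner_diff_right)
    also have "\<dots> \<le> norm (y - x) * norm (polar M y - polar M x)"
      by (rule norm_cauchy_schwarz)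
    finally show ?thesis
      by (cases "y = x") (simp_all add: field_simps)
  qed
  have "((\<lambda>y. norm (polar M y - polar M x)) \<longlongrightarrow> 0) (at x)"
    using isCont_polar[OF assms] unfolding isCont_def
    by (intro tendsto_norm_zero) (simp add: LIM_zero)
  then show "(?e \<longlongrightarrow> 0) (at x)"
    by (rule Lim_null_comparison[rotated]) (intro always_eventually allI bound)
qed

text \<open>For \<open>s = sgn c\<close> the function \<open>M\<^sup>0(x) M(\<xi>) - s \<langle>x, \<xi>\<rangle>\<close> is nonnegative and vanishes at
  \<open>\<xi> = c polar M x\<close>. So its derivative vanishes there, and this determines the gradient of \<open>M\<close>.\<close>
lemma GDERIV_minkowski_polar:
  assumes "x \<noteq> 0" "c \<noteq> 0"
  shows "GDERIV M (c *\<^sub>R polar M x) :> (sgn c / dual_norm M x) *\<^sub>R x"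
proof -
  let ?\<xi> = "c *\<^sub>R polar M x" and ?N = "dual_norm M x"
  have "?\<xi> \<noteq> 0" using polar_unit[of x] minkowski_zero assms(2) by auto
  then obtain D where D: "GDERIV M ?\<xi> :> D" by (rule minkowski_differentiable)
  let ?f = "\<lambda>\<xi>. ?N * M \<xi> - sgn c * (x \<bullet> \<xi>)"
  have der: "(?f has_derivative (\<lambda>h. ?N * (h \<bullet> D) - sgn c * (x \<bullet> h))) (at ?\<xi>)"
    using D unfolding gderiv_def by (auto intro!: derivative_eq_intros)
  have "?f ?\<xi> \<le> ?f \<eta>" for \<eta>
  proof -
    have "?f ?\<xi> = 0"
      by (simp add: minkowski_scale polar_unit polar_attains abs_sgn)
    moreover have "sgn c * (x \<bullet> \<eta>) \<le> ?N * M \<eta>"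
      using inner_le_dual_norm[of x "sgn c *\<^sub>R \<eta>"] assms(2) by (simp add: minkowski_scale sgn_if split: if_splits)
    ultimately show ?thesis by simp
  qed
  then have "(\<lambda>h. ?N * (h \<bullet> D) - sgn c * (x \<bullet> h)) = (\<lambda>h. 0)"
    by (intro differential_zero_maxmin[OF _ open_UNIV der]) auto
  then have "?N * (h \<bullet> D) = sgn c * (x \<bullet> h)" for h
    by (metis eq_iff_diff_eq_0)
  then have "h \<bullet> D = h \<bullet> ((sgn c / ?N) *\<^sub>R x)" for h
    using dual_norm_pos[OF assms(1)] by (simp add: field_simps inner_commute[of x])
  then have "D = (sgn c / ?N) *\<^sub>R x"
    by (metis vector_eq_ldot)
  with D show ?thesis by simp
qed

lemma minkowski_scaleR_polar: "M (c *\<^sub>R polar M x) = \<bar>c\<bar>"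
  by (simp add: minkowski_scale polar_unit)

text \<open>This cancels the nonlinearity of the operator: the map \<open>\<xi> \<mapsto> M(\<xi>) \<nabla>M(\<xi>)\<close> sends multiples of
  \<open>\<nabla>M\<^sup>0(x)\<close> to multiples of \<open>x\<close>. For \<open>c = 0\<close> both sides are zero, whatever the meaningless gradient of \<open>M\<close> at
  the origin.\<close>
lemma minkowski_grad_polar:
  assumes "x \<noteq> 0 \<or> c = 0"
  shows "M (c *\<^sub>R polar M x) *\<^sub>R grad M (c *\<^sub>R polar M x) = (c / dual_norm M x) *\<^sub>R x"
proof (cases "c = 0")
  case False
  then show ?thesis
    using assms by (simp add: minkowski_scaleR_polar grad_eqI[OF GDERIV_minkowski_polar] abs_sgn mult.commute)
qed (simp add: minkowski_zero)

text \<open>A power larger than one smooths the dual norm at the origin, by its Lipschitz bound.\<close>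
lemma GDERIV_dual_norm_powr:
  assumes "1 < q"
  shows "GDERIV (\<lambda>y. dual_norm M y powr q) x :> (q * dual_norm M x powr (q - 1)) *\<^sub>R polar M x"
proof (cases "x = 0")
  case False
  then show ?thesis
    using GDERIV_DERIV_compose[OF GDERIV_dual_norm has_real_derivative_powr[of _ q]] dual_norm_pos by simp
next
  case True
  obtain B where "0 \<le> B" and "\<And>x y. \<bar>dual_norm M y - dual_norm M x\<bar> \<le> B * norm (y - x)"
    by (rule dual_norm_lipschitz) blast
  then have B: "dual_norm M y \<le> B * norm y" for y
    by (metis abs_of_nonneg dual_norm_nonneg dual_norm_zero diff_zero)
  have bound: "norm (dual_norm M y powr q /\<^sub>R norm y) \<le> dual_norm M y powr (q - 1) * B" for y
  proof (cases "y = 0")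
    case False
    have "dual_norm M y powr q = dual_norm M y powr (q - 1) * dual_norm M y"
      using dual_norm_pos[OF False] by (simp add: powr_diff)
    also have "\<dots> \<le> dual_norm M y powr (q - 1) * (B * norm y)"
      by (intro mult_left_mono B) simp
    finally show ?thesis using False by (simp add: field_simps)
  qed (simp add: dual_norm_zero)
  have "((\<lambda>y. dual_norm M y powr (q - 1) * B) \<longlongrightarrow> 0) (at 0)"
  proof -
    have "(dual_norm M \<longlongrightarrow> 0) (at 0)"
      using dual_norm_continuous by (metis continuous_on_def UNIV_I dual_norm_zero)
    then have "((\<lambda>y. dual_norm M y powr (q - 1)) \<longlongrightarrow> 0) (at 0)"
      using assms by (intro tendsto_zero_powrI[OF _ tendsto_const]) (auto simp: dual_norm_nonneg)
    then show ?thesis by (rule tendsto_mult_left_zero)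
  qed
  then have "((\<lambda>y. dual_norm M y powr q /\<^sub>R norm y) \<longlongrightarrow> 0) (at 0)"
    by (rule Lim_null_comparison[rotated]) (intro always_eventually allI bound)
  then show ?thesis
    using True assms by (simp add: gderiv_def has_derivative_at_within dual_norm_zero)
qed

end

section \<open>The odd power function\<close>
lemma rpow_pos: "0 < x \<Longrightarrow> rpow x a = x powr a"
  by (simp add: rpow_def)

lemma rpow_mult: "0 \<le> x \<Longrightarrow> 0 \<le> y \<Longrightarrow> rpow (x * y) a = rpow x a * rpow y a"
  by (simp add: rpow_def powr_mult)

lemma rpow_square_half:
  assumes "0 \<le> x" shows "rpow (x\<^sup>2) (a / 2) = rpow x a"
proof (cases "x = 0")
  case False
  then have "x\<^sup>2 = x powr 2" using assms by simp
  then show ?thesis by (simp add: rpow_def powr_powr)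
qed (simp add: rpow_def)

text \<open>The derivative of \<open>|s|\<^sup>e s\<close>, to be used with \<open>e = p - 2\<close>. At \<open>s = 0\<close> the difference quotient is
  \<open>|s|\<^sup>e\<close>, which has a limit only for \<open>e \<ge> 0\<close>: this is why zeros of \<open>F'\<close> are excluded for \<open>p < 2\<close>.\<close>
lemma DERIV_rpow_abs_mult:
  assumes "s \<noteq> 0 \<or> 0 \<le> e"
  shows "((\<lambda>s. rpow \<bar>s\<bar> e * s) has_real_derivative (e + 1) * rpow \<bar>s\<bar> e) (at s)"
proof (cases "e = 0")
  case True
  then show ?thesis by (simp add: rpow_def)
next
  case e: False
  show ?thesis
  proof (cases "s = 0")
    case False
    have "(abs has_real_derivative sgn s) (at s)"
      using GDERIV_norm[OF False] by simp
    then have "((\<lambda>s. \<bar>s\<bar> powr e) has_real_derivative e * \<bar>s\<bar> powr (e - 1) * sgn s) (at s)"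
      using DERIV_fun_powr[of abs "sgn s" s e] False by simp
    then have "((\<lambda>s. \<bar>s\<bar> powr e * s) has_real_derivative e * \<bar>s\<bar> powr (e - 1) * sgn s * s + \<bar>s\<bar> powr e) (at s)"
      by (rule DERIV_cong[OF DERIV_mult[OF _ DERIV_ident]]) simp
    moreover have "\<bar>s\<bar> powr (e - 1) * sgn s * s = \<bar>s\<bar> powr e"
      using False by (simp add: powr_diff sgn_if)
    ultimately show ?thesis using e by (simp add: rpow_def distrib_right mult.assoc)
  next
    case True
    then have "0 < e" using assms e by simp
    then have "((\<lambda>s. \<bar>s\<bar> powr e) \<longlongrightarrow> 0) (at (0::real))"
      by (intro tendsto_zero_powrI[OF _ tendsto_const]) (auto intro!: tendsto_eq_intros)
    then have "isCont (\<lambda>s::real. \<bar>s\<bar> powr e) 0"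
      by (simp add: isCont_def)
    then show ?thesis
      using True e \<open>0 < e\<close> unfolding CARAT_DERIV by (intro exI[of _ "\<lambda>s. \<bar>s\<bar> powr e"]) (simp add: rpow_def)
  qed
qed

section \<open>Divergence of multiples of the dilation field\<close>

text \<open>The infinitesimal generator of the anisotropic dilations \<open>(z, \<sigma>) \<mapsto> (\<lambda>z, \<lambda>\<^sup>c\<sigma>)\<close>.\<close>
definition dilation_field :: "real \<Rightarrow> 'a::euclidean_space \<times> 'b::euclidean_space \<Rightarrow> 'a \<times> 'b" where
  "dilation_field c = (\<lambda>(z, \<sigma>). (z, c *\<^sub>R \<sigma>))"

text \<open>The field is linear and diagonal with entries \<open>dilation_field c i \<bullet> i\<close>, so its \<open>i\<close>-th component is
  affine along a line in direction \<open>i\<close>.\<close>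
lemma dilation_field_diagonal:
  assumes "i \<in> Basis"
  shows "dilation_field c (x + t *\<^sub>R i) \<bullet> i = (dilation_field c i \<bullet> i) * (x \<bullet> i + t)"
  using assms by (cases x) (auto simp: Basis_prod_def dilation_field_def inner_add_left distrib_left)

lemma dilation_field_trace:
  "(\<Sum>i\<in>Basis. dilation_field c i \<bullet> (i :: 'a::euclidean_space \<times> 'b::euclidean_space))
     = real DIM('a) + c * real DIM('b)"
  unfolding Basis_prod_def
  by (subst sum.union_disjoint) (auto simp: sum.reindex inj_on_def dilation_field_def)

lemma eventually_along_line:
  fixes x i :: "'a::real_normed_vector"
  assumes "\<forall>\<^sub>F y in nhds x. P y"
  shows "\<forall>\<^sub>F t in nhds 0. P (x + t *\<^sub>R i)"
proof -
  have "((\<lambda>t. x + t *\<^sub>R i) \<longlongrightarrow> x + 0 *\<^sub>R i) (at 0)"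
    by (intro tendsto_intros)
  then have "((\<lambda>t. x + t *\<^sub>R i) \<longlongrightarrow> x) (nhds 0)"
    using tendsto_at_iff_tendsto_nhds[of "\<lambda>t. x + t *\<^sub>R i" 0] by simp
  with assms show ?thesis by (rule eventually_compose_filterlim)
qed

lemma divergence_by_partials:
  fixes V :: "'a::euclidean_space \<Rightarrow> 'a"
  assumes "\<And>i. i \<in> Basis \<Longrightarrow> ((\<lambda>t. V (x + t *\<^sub>R i) \<bullet> i) has_real_derivative d i) (at 0)"
  shows "has_div_at V x" and "diverg V x = (\<Sum>i\<in>Basis. d i)"
proof -
  show "has_div_at V x"
    unfolding has_div_at_def using assms real_differentiable_def by blast
  show "diverg V x = (\<Sum>i\<in>Basis. d i)"
    unfolding diverg_def using assms by (intro sum.cong) (auto intro: DERIV_imp_deriv)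
qed

text \<open>The product rule \<open>div (h X) = X h + h div X\<close>, where the derivative \<open>X h\<close> along \<open>X\<close> arises from the partial
  derivatives of \<open>h\<close> by linearity of \<open>h'\<close>.\<close>
lemma divergence_scaled_dilation_field:
  fixes V :: "'a::euclidean_space \<times> 'b::euclidean_space \<Rightarrow> 'a \<times> 'b"
  assumes V: "\<forall>\<^sub>F y in nhds x. V y = h y *\<^sub>R dilation_field c y"
    and h: "(h has_derivative h') (at x)"
  shows "has_div_at V x"
    and "diverg V x = h' (dilation_field c x) + h x * (real DIM('a) + c * real DIM('b))"
proof -
  interpret h': bounded_linear h' using h by (rule has_derivative_bounded_linear)
  let ?X = "dilation_field c :: 'a \<times> 'b \<Rightarrow> 'a \<times> 'b"
  define d where "d i = h' i * (?X x \<bullet> i) + h x * (?X i \<bullet> i)" for i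
  have d: "((\<lambda>t. V (x + t *\<^sub>R i) \<bullet> i) has_real_derivative d i) (at 0)" if i: "i \<in> Basis" for i
  proof -
    have ev: "\<forall>\<^sub>F t in nhds 0. V (x + t *\<^sub>R i) \<bullet> i = h (x + t *\<^sub>R i) * ((?X i \<bullet> i) * (x \<bullet> i + t))"
      using eventually_along_line[OF V, of i]
      by eventually_elim (simp add: dilation_field_diagonal[OF i])
    have "((\<lambda>t. x + t *\<^sub>R i) has_derivative (\<lambda>t. t *\<^sub>R i)) (at 0)"
      by (auto intro!: derivative_eq_intros)
    moreover have "(h has_derivative h') (at (x + 0 *\<^sub>R i))" using h by simp
    ultimately have "((\<lambda>t. h (x + t *\<^sub>R i)) has_derivative (\<lambda>t. h' (t *\<^sub>R i))) (at 0)"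
      by (rule has_derivative_compose)
    then have "((\<lambda>t. h (x + t *\<^sub>R i)) has_real_derivative h' i) (at 0)"
      by (simp add: has_field_derivative_def h'.scaleR mult.commute[of _ "h' i"])
    then have "((\<lambda>t. h (x + t *\<^sub>R i) * ((?X i \<bullet> i) * (x \<bullet> i + t))) has_real_derivative
        h' i * ((?X i \<bullet> i) * (x \<bullet> i)) + h x * (?X i \<bullet> i)) (at 0)"
      by (auto intro!: derivative_eq_intros)
    moreover have "?X x \<bullet> i = (?X i \<bullet> i) * (x \<bullet> i)"
      using dilation_field_diagonal[OF i, of c x 0] by simp
    ultimately show ?thesis
      by (subst DERIV_cong_ev[OF refl ev refl]) (simp add: d_def)
  qed
  show "has_div_at V x"
    using d by (rule divergence_by_partials)
  have "diverg V x = (\<Sum>i\<in>Basis. d i)"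
    using d by (rule divergence_by_partials)
  also have "\<dots> = h' (\<Sum>i\<in>Basis. (?X x \<bullet> i) *\<^sub>R i) + h x * (\<Sum>i\<in>Basis. ?X i \<bullet> i)"
    by (simp add: d_def sum.distrib sum_distrib_left h'.sum h'.scaleR mult.commute)
  finally show "diverg V x = h' (?X x) + h x * (real DIM('a) + c * real DIM('b))"
    by (simp add: euclidean_representation dilation_field_trace)
qed

text \<open>The substitute for the product rule at points with \<open>z = 0\<close>, where \<open>h\<close> need only be continuous: in
  \<open>z\<close>-directions the component of \<open>X\<close> is proportional to the parameter \<open>t\<close>, so \<open>h\<close> itself is the difference
  quotient; in \<open>\<sigma>\<close>-directions \<open>h\<close> is identically zero.\<close>
lemma divergence_scaled_dilation_field_degenerate:
  fixes V :: "'a::euclidean_space \<times> 'b::euclidean_space \<Rightarrow> 'a \<times> 'b"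
  assumes V: "\<forall>\<^sub>F y in nhds (0, \<sigma>). V y = h y *\<^sub>R dilation_field c y"
    and cont: "isCont h (0, \<sigma>)"
    and zero: "\<And>\<tau>. h (0, \<tau>) = 0"
  shows "has_div_at V (0, \<sigma>)" and "diverg V (0, \<sigma>) = 0"
proof -
  let ?X = "dilation_field c :: 'a \<times> 'b \<Rightarrow> 'a \<times> 'b"
  have d: "((\<lambda>t. V ((0, \<sigma>) + t *\<^sub>R i) \<bullet> i) has_real_derivative 0) (at 0)" if i: "i \<in> Basis" for i
  proof -
    have ev: "\<forall>\<^sub>F t in nhds 0. V ((0, \<sigma>) + t *\<^sub>R i) \<bullet> i
        = h ((0, \<sigma>) + t *\<^sub>R i) * ((?X i \<bullet> i) * ((0, \<sigma>) \<bullet> i + t))"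
      using eventually_along_line[OF V, of i]
      by eventually_elim (simp add: dilation_field_diagonal[OF i])
    have "((\<lambda>t. h ((0, \<sigma>) + t *\<^sub>R i) * ((?X i \<bullet> i) * ((0, \<sigma>) \<bullet> i + t))) has_real_derivative 0) (at 0)"
    proof (cases "fst i = 0")
      case True
      then have "h ((0, \<sigma>) + t *\<^sub>R i) = 0" for t
        by (cases i) (simp add: zero)
      then show ?thesis by simp
    next
      case False
      then have "(0, \<sigma>) \<bullet> i = 0" using i by (auto simp: Basis_prod_def)
      moreover have "isCont (\<lambda>t. h ((0, \<sigma>) + t *\<^sub>R i)) 0"
        by (rule isCont_o2[where g = h]) (auto intro!: continuous_intros cont)
      ultimately show ?thesis
        unfolding CARAT_DERIV using zero
        by (intro exI[of _ "\<lambda>t. h ((0, \<sigma>) + t *\<^sub>R i) * (?X i \<bullet> i)"]) (auto intro!: continuous_intros)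
    qed
    then show ?thesis by (subst DERIV_cong_ev[OF refl ev refl])
  qed
  show "has_div_at V (0, \<sigma>)"
    using d by (rule divergence_by_partials)
  show "diverg V (0, \<sigma>) = 0"
    using divergence_by_partials(2)[OF d] by simp
qed

section \<open>Functions of \<open>\<rho>\<close>\<close>
context
  fixes \<Phi> :: "'a::euclidean_space \<Rightarrow> real" and \<Psi> :: "'b::euclidean_space \<Rightarrow> real" and \<alpha> :: real
  assumes \<Phi>: "minkowski_norm \<Phi>" and \<Psi>: "minkowski_norm \<Psi>" and \<alpha>: "0 < \<alpha>"
begin

lemma rho_base_pos:
  assumes "(z, \<sigma>) \<noteq> 0"
  shows "0 < dual_norm \<Phi> z powr (2 * (\<alpha> + 1)) + 4 * (\<alpha> + 1)\<^sup>2 * (dual_norm \<Psi> \<sigma>)\<^sup>2"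
proof (cases "z = 0")
  case True
  then have "\<sigma> \<noteq> 0" using assms by (auto simp: zero_prod_def)
  then show ?thesis
    using dual_norm_pos[OF \<Psi> \<open>\<sigma> \<noteq> 0\<close>] \<alpha> by (intro add_nonneg_pos mult_pos_pos) simp_all
next
  case False
  then show ?thesis
    using dual_norm_pos[OF \<Phi> False] by (intro add_pos_nonneg) auto
qed

lemma rho_pos: "x \<noteq> 0 \<Longrightarrow> 0 < rho \<alpha> \<Phi> \<Psi> x"
  using rho_base_pos[of "fst x" "snd x"] by (simp add: rho_def split_beta)

lemma rho_powr:
  assumes "(z, \<sigma>) \<noteq> 0"
  shows "rho \<alpha> \<Phi> \<Psi> (z, \<sigma>) powr (2 * (\<alpha> + 1))
    = dual_norm \<Phi> z powr (2 * (\<alpha> + 1)) + 4 * (\<alpha> + 1)\<^sup>2 * (dual_norm \<Psi> \<sigma>)\<^sup>2"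
  using rho_base_pos[OF assms] \<alpha> by (simp add: rho_def powr_powr)

text \<open>The root is taken of \<open>(\<Phi>\<^sup>0)\<^bsup>2(\<alpha>+1)\<^esup> + 4(\<alpha>+1)\<^sup>2(\<Psi>\<^sup>0)\<^sup>2\<close>, whose exponents exceed one; hence \<open>\<rho>\<close> is
  differentiable also at points where just one of \<open>z\<close> and \<open>\<sigma>\<close> vanishes.\<close>
lemma has_derivative_rho:
  assumes nz: "(z, \<sigma>) \<noteq> 0"
  shows "(rho \<alpha> \<Phi> \<Psi> has_derivative
    (\<lambda>h. rho \<alpha> \<Phi> \<Psi> (z, \<sigma>) powr (- (2 * \<alpha> + 1)) *
      (dual_norm \<Phi> z powr (2 * \<alpha> + 1) * (fst h \<bullet> polar \<Phi> z)
        + 4 * (\<alpha> + 1) * dual_norm \<Psi> \<sigma> * (snd h \<bullet> polar \<Psi> \<sigma>)))) (at (z, \<sigma>))"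
proof -
  let ?q = "2 * (\<alpha> + 1)" and ?P = "dual_norm \<Phi>" and ?R = "dual_norm \<Psi>"
  define S where "S = (\<lambda>w. ?P (fst w) powr ?q + 4 * (\<alpha> + 1)\<^sup>2 * ?R (snd w) powr 2)"
  have S_eq: "S (z, \<sigma>) = ?P z powr ?q + 4 * (\<alpha> + 1)\<^sup>2 * (?R \<sigma>)\<^sup>2" for z \<sigma>
    using dual_norm_nonneg[OF \<Psi>] by (cases "?R \<sigma> = 0") (simp_all add: S_def less_le)
  have rho_eq: "rho \<alpha> \<Phi> \<Psi> = (\<lambda>w. S w powr (1 / ?q))"
  proof (rule ext)
    show "rho \<alpha> \<Phi> \<Psi> w = S w powr (1 / ?q)" for w
      by (cases w) (simp only: rho_def S_eq prod.case)
  qed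
  have S_pos: "0 < S (z, \<sigma>)"
    using rho_base_pos[OF nz] by (simp add: S_eq)
  have Pq: "((\<lambda>z. ?P z powr ?q) has_derivative (\<lambda>h. h \<bullet> ((?q * ?P z powr (?q - 1)) *\<^sub>R polar \<Phi> z))) (at (fst (z, \<sigma>)))"
    using GDERIV_dual_norm_powr[OF \<Phi>, of ?q z] \<alpha> by (simp add: gderiv_def)
  have R2: "((\<lambda>\<sigma>. ?R \<sigma> powr 2) has_derivative (\<lambda>h. h \<bullet> ((2 * ?R \<sigma> powr (2 - 1)) *\<^sub>R polar \<Psi> \<sigma>))) (at (snd (z, \<sigma>)))"
    using GDERIV_dual_norm_powr[OF \<Psi>, of 2 \<sigma>] by (simp add: gderiv_def)
  have "(S has_derivative (\<lambda>h. fst h \<bullet> ((?q * ?P z powr (?q - 1)) *\<^sub>R polar \<Phi> z)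
      + 4 * (\<alpha> + 1)\<^sup>2 * (snd h \<bullet> ((2 * ?R \<sigma> powr (2 - 1)) *\<^sub>R polar \<Psi> \<sigma>)))) (at (z, \<sigma>))"
    unfolding S_def
    by (intro has_derivative_add has_derivative_mult_right has_derivative_fst has_derivative_snd
        has_derivative_ident has_derivative_compose[where f = fst and x = "(z, \<sigma>)", OF _ Pq]
        has_derivative_compose[where f = snd and x = "(z, \<sigma>)", OF _ R2])
  from DERIV_compose_FDERIV[OF has_real_derivative_powr[OF S_pos, of "1 / ?q"] this]
  have der: "(rho \<alpha> \<Phi> \<Psi> has_derivative
      (\<lambda>h. (fst h \<bullet> ((?q * ?P z powr (?q - 1)) *\<^sub>R polar \<Phi> z)
      + 4 * (\<alpha> + 1)\<^sup>2 * (snd h \<bullet> ((2 * ?R \<sigma> powr (2 - 1)) *\<^sub>R polar \<Psi> \<sigma>)))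
       * (1 / ?q * S (z, \<sigma>) powr (1 / ?q - 1)))) (at (z, \<sigma>))"
    unfolding rho_eq .
  have exponent: "S (z, \<sigma>) powr (1 / ?q - 1) = rho \<alpha> \<Phi> \<Psi> (z, \<sigma>) powr (- (2 * \<alpha> + 1))"
    using \<alpha> by (simp add: rho_eq powr_powr field_simps)
  have R1: "?R \<sigma> powr (2 - 1) = ?R \<sigma>"
    using dual_norm_nonneg[OF \<Psi>] by simp
  show ?thesis
    by (rule has_derivative_eq_rhs[OF der], rule ext, unfold exponent R1)
      (use \<alpha> in \<open>simp add: field_simps inner_add_right power2_eq_square\<close>)
qed

text \<open>With \<open>r = \<rho>(z,\<sigma>)\<close> and \<open>k = d r\<^bsup>-(2\<alpha>+1)\<^esup>\<close>, the partial gradients are multiples \<open>a\<close> and \<open>b\<close> of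
  \<open>polar \<Phi> z\<close> and \<open>polar \<Psi> \<sigma>\<close>, so duality makes the vector part of the flux equal to
  \<open>k \<Phi>\<^sup>0(z)\<^bsup>2\<alpha>\<^esup> X\<close>. The base of the power \<open>(p - 2) / 2\<close> contains the sum under the root in
  \<open>\<rho>\<close> as a factor and hence equals \<open>(|d| r\<^bsup>-\<alpha>\<^esup> \<Phi>\<^sup>0(z)\<^bsup>\<alpha>\<^esup>)\<^sup>2\<close>.\<close>
lemma flux_of_radial_function:
  assumes nz: "(z, \<sigma>) \<noteq> 0"
    and F: "(F has_real_derivative d) (at (rho \<alpha> \<Phi> \<Psi> (z, \<sigma>)))"
  shows "L_flux \<alpha> p \<Phi> \<Psi> (F \<circ> rho \<alpha> \<Phi> \<Psi>) (z, \<sigma>) =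
    (rpow \<bar>d\<bar> (p - 2) * d * rho \<alpha> \<Phi> \<Psi> (z, \<sigma>) powr (- (\<alpha> * p + 1))
      * dual_norm \<Phi> z powr (\<alpha> * p)) *\<^sub>R dilation_field (\<alpha> + 1) (z, \<sigma>)"
proof -
  let ?\<rho> = "rho \<alpha> \<Phi> \<Psi>"
  define r where "r = ?\<rho> (z, \<sigma>)"
  define P where "P = dual_norm \<Phi> z"
  define R where "R = dual_norm \<Psi> \<sigma>"
  define k where "k = d * r powr (- (2 * \<alpha> + 1))"
  define a where "a = k * P powr (2 * \<alpha> + 1)"
  define b where "b = k * (4 * (\<alpha> + 1) * R)"
  have r: "0 < r" using rho_pos[OF nz] by (simp add: r_def)
  have P: "0 \<le> P" and P0: "P = 0 \<longleftrightarrow> z = 0"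
    using dual_norm_nonneg[OF \<Phi>] dual_norm_pos[OF \<Phi>] dual_norm_zero[OF \<Phi>] by (auto simp: P_def less_le)
  have R: "0 \<le> R" and R0: "R = 0 \<longleftrightarrow> \<sigma> = 0"
    using dual_norm_nonneg[OF \<Psi>] dual_norm_pos[OF \<Psi>] dual_norm_zero[OF \<Psi>] by (auto simp: R_def less_le)
  have der: "((F \<circ> ?\<rho>) has_derivative (\<lambda>h. a * (fst h \<bullet> polar \<Phi> z) + b * (snd h \<bullet> polar \<Psi> \<sigma>))) (at (z, \<sigma>))"
    using DERIV_compose_FDERIV[OF F has_derivative_rho[OF nz]]
    unfolding o_def r_def[symmetric] P_def[symmetric] R_def[symmetric]
    by (rule has_derivative_eq_rhs) (auto simp: a_def b_def k_def algebra_simps)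
  have gz: "grad (\<lambda>z'. (F \<circ> ?\<rho>) (z', \<sigma>)) z = a *\<^sub>R polar \<Phi> z"
  proof (rule grad_eqI, unfold gderiv_def)
    have "((\<lambda>z'. (z', \<sigma>)) has_derivative (\<lambda>h. (h, 0))) (at z)"
      by (auto intro!: derivative_eq_intros)
    from has_derivative_compose[OF this der]
    show "((\<lambda>z'. (F \<circ> ?\<rho>) (z', \<sigma>)) has_derivative (\<lambda>h. h \<bullet> a *\<^sub>R polar \<Phi> z)) (at z)"
      by simp
  qed
  have gs: "grad (\<lambda>\<sigma>'. (F \<circ> ?\<rho>) (z, \<sigma>')) \<sigma> = b *\<^sub>R polar \<Psi> \<sigma>"
  proof (rule grad_eqI, unfold gderiv_def)
    have "((\<lambda>\<sigma>'. (z, \<sigma>')) has_derivative (\<lambda>h. (0, h))) (at \<sigma>)"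
      by (auto intro!: derivative_eq_intros)
    from has_derivative_compose[OF this der]
    show "((\<lambda>\<sigma>'. (F \<circ> ?\<rho>) (z, \<sigma>')) has_derivative (\<lambda>h. h \<bullet> b *\<^sub>R polar \<Psi> \<sigma>)) (at \<sigma>)"
      by simp
  qed
  have Az: "\<Phi> (a *\<^sub>R polar \<Phi> z) *\<^sub>R grad \<Phi> (a *\<^sub>R polar \<Phi> z) = (k * P powr (2 * \<alpha>)) *\<^sub>R z"
  proof -
    have "z \<noteq> 0 \<or> a = 0" using P0 by (auto simp: a_def)
    from minkowski_grad_polar[OF \<Phi> this] show ?thesis
      using P P0 by (cases "z = 0") (simp_all add: a_def powr_add flip: P_def)
  qed
  have As: "\<Psi> (b *\<^sub>R polar \<Psi> \<sigma>) *\<^sub>R grad \<Psi> (b *\<^sub>R polar \<Psi> \<sigma>) = (k * (4 * (\<alpha> + 1))) *\<^sub>R \<sigma>"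
  proof -
    have "\<sigma> \<noteq> 0 \<or> b = 0" using R0 by (auto simp: b_def)
    from minkowski_grad_polar[OF \<Psi> this] show ?thesis
      using R0 by (cases "\<sigma> = 0") (simp_all add: b_def flip: R_def)
  qed
  have vec: "(\<Phi> (a *\<^sub>R polar \<Phi> z) *\<^sub>R grad \<Phi> (a *\<^sub>R polar \<Phi> z),
      (P powr (2 * \<alpha>) / 4 * \<Psi> (b *\<^sub>R polar \<Psi> \<sigma>)) *\<^sub>R grad \<Psi> (b *\<^sub>R polar \<Psi> \<sigma>))
    = (k * P powr (2 * \<alpha>)) *\<^sub>R dilation_field (\<alpha> + 1) (z, \<sigma>)"
    unfolding scaleR_scaleR[of "P powr (2 * \<alpha>) / 4", symmetric] Az As
    by (simp add: dilation_field_def)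
  have energy: "(\<Phi> (a *\<^sub>R polar \<Phi> z))\<^sup>2 + P powr (2 * \<alpha>) / 4 * (\<Psi> (b *\<^sub>R polar \<Psi> \<sigma>))\<^sup>2
      = (\<bar>d\<bar> * (r powr (- \<alpha>) * P powr \<alpha>))\<^sup>2"
  proof -
    have "(\<Phi> (a *\<^sub>R polar \<Phi> z))\<^sup>2 + P powr (2 * \<alpha>) / 4 * (\<Psi> (b *\<^sub>R polar \<Psi> \<sigma>))\<^sup>2
        = k\<^sup>2 * ((P powr (2 * \<alpha> + 1))\<^sup>2 + P powr (2 * \<alpha>) * (4 * (\<alpha> + 1)\<^sup>2 * R\<^sup>2))"
      unfolding minkowski_scaleR_polar[OF \<Phi>] minkowski_scaleR_polar[OF \<Psi>]
      by (simp add: a_def b_def power2_eq_square field_simps)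
    also have "(P powr (2 * \<alpha> + 1))\<^sup>2 = P powr (2 * \<alpha>) * P powr (2 * (\<alpha> + 1))"
      by (simp add: power2_eq_square flip: powr_add)
    also have "k\<^sup>2 * (P powr (2 * \<alpha>) * P powr (2 * (\<alpha> + 1)) + P powr (2 * \<alpha>) * (4 * (\<alpha> + 1)\<^sup>2 * R\<^sup>2))
        = k\<^sup>2 * P powr (2 * \<alpha>) * r powr (2 * (\<alpha> + 1))"
      using rho_powr[OF nz] by (simp add: P_def R_def r_def distrib_left)
    also have "k\<^sup>2 * P powr (2 * \<alpha>) * r powr (2 * (\<alpha> + 1))
        = d\<^sup>2 * (r powr (- (2 * \<alpha> + 1)) * r powr (- (2 * \<alpha> + 1)) * r powr (2 * (\<alpha> + 1))) * P powr (2 * \<alpha>)"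
      by (simp add: k_def power2_eq_square)
    also have "r powr (- (2 * \<alpha> + 1)) * r powr (- (2 * \<alpha> + 1)) * r powr (2 * (\<alpha> + 1)) = (r powr (- \<alpha>))\<^sup>2"
      by (simp add: power2_eq_square algebra_simps flip: powr_add)
    moreover have "P powr (2 * \<alpha>) = (P powr \<alpha>)\<^sup>2"
      by (simp add: power2_eq_square flip: powr_add)
    ultimately show ?thesis by (simp add: power_mult_distrib)
  qed
  have weight: "rpow (\<bar>d\<bar> * (r powr (- \<alpha>) * P powr \<alpha>)) (p - 2) * (k * P powr (2 * \<alpha>))
      = rpow \<bar>d\<bar> (p - 2) * d * r powr (- (\<alpha> * p + 1)) * P powr (\<alpha> * p)"
  proof (cases "P = 0")
    case False
    with P have "0 < P" by simp
    then have "rpow (r powr (- \<alpha>) * P powr \<alpha>) (p - 2) = r powr (- \<alpha> * (p - 2)) * P powr (\<alpha> * (p - 2))"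
      using r by (simp add: rpow_pos powr_mult powr_powr)
    moreover have "r powr (- (\<alpha> * p + 1)) = r powr (- \<alpha> * (p - 2)) * r powr (- (2 * \<alpha> + 1))"
      by (simp add: algebra_simps flip: powr_add)
    moreover have "P powr (\<alpha> * p) = P powr (\<alpha> * (p - 2)) * P powr (2 * \<alpha>)"
      by (simp add: algebra_simps flip: powr_add)
    ultimately show ?thesis
      by (simp add: rpow_mult k_def)
  qed simp
  show ?thesis
    unfolding L_flux_def Let_def prod.case gz gs P_def[symmetric] vec energy
    by (simp only: rpow_square_half abs_ge_zero powr_ge_zero mult_nonneg_nonneg scaleR_scaleR weight flip: r_def)
qed

text \<open>The divergence of the collapsed flux \<open>h X\<close>, with \<open>h = G(\<rho>) (\<Phi>\<^sup>0)\<^bsup>\<alpha>p\<^esup>\<close> and \<open>G\<close> containing all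
  factors that depend on \<open>\<rho>\<close> alone. Asking for the derivatives of \<open>F\<close> explicitly makes the result directly
  applicable to powers and to the logarithm.\<close>
lemma L_of_radial_function:
  assumes p: "1 < p" and nz: "(z, \<sigma>) \<noteq> 0"
    and F: "\<And>r. 0 < r \<Longrightarrow> (F has_real_derivative F' r) (at r)"
    and F': "(F' has_real_derivative F2) (at (rho \<alpha> \<Phi> \<Psi> (z, \<sigma>)))"
    and nondeg: "p < 2 \<Longrightarrow> F' (rho \<alpha> \<Phi> \<Psi> (z, \<sigma>)) \<noteq> 0"
    and Q: "Q = real DIM('a) + (\<alpha> + 1) * real DIM('b)"
  defines "r \<equiv> rho \<alpha> \<Phi> \<Psi> (z, \<sigma>)"
  shows "L_defined_at \<alpha> p \<Phi> \<Psi> (F \<circ> rho \<alpha> \<Phi> \<Psi>) (z, \<sigma>)" (is ?defined)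
    and "L_op \<alpha> p \<Phi> \<Psi> (F \<circ> rho \<alpha> \<Phi> \<Psi>) (z, \<sigma>) =
      (p - 1) * rpow \<bar>F' r\<bar> (p - 2) * (F2 + (Q - 1) / (p - 1) * (F' r / r))
        * (dual_norm \<Phi> z / r) powr (\<alpha> * p)" (is ?formula)
proof -
  let ?\<rho> = "rho \<alpha> \<Phi> \<Psi>"
  define V where "V = L_flux \<alpha> p \<Phi> \<Psi> (F \<circ> ?\<rho>)"
  define G where "G = (\<lambda>s. rpow \<bar>F' s\<bar> (p - 2) * F' s * s powr (- (\<alpha> * p + 1)))"
  define h where "h = (\<lambda>y. G (?\<rho> y) * dual_norm \<Phi> (fst y) powr (\<alpha> * p))"
  define D where "D = rpow \<bar>F' r\<bar> (p - 2)"
  define G' where "G' = (p - 1) * D * F2 * r powr (- (\<alpha> * p + 1))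
      - (\<alpha> * p + 1) * r powr (- (\<alpha> * p + 1) - 1) * (D * F' r)"
  have r: "0 < r" using rho_pos[OF nz] by (simp add: r_def)
  have ev_nz: "\<forall>\<^sub>F y in nhds (z, \<sigma>). y \<noteq> 0"
    using nz by (rule t1_space_nhds)
  have V: "\<forall>\<^sub>F y in nhds (z, \<sigma>). V y = h y *\<^sub>R dilation_field (\<alpha> + 1) y"
    using ev_nz
  proof eventually_elim
    case (elim y)
    then show ?case
      using flux_of_radial_function[of "fst y" "snd y" F "F' (?\<rho> y)" p] F rho_pos[of y]
      by (simp add: V_def h_def G_def)
  qed
  have "\<forall>\<^sub>F y in nhds (z, \<sigma>). (F \<circ> ?\<rho>) differentiable (at y)"
    using ev_nz
  proof eventually_elim
    case (elim y)
    then show ?case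
      using DERIV_compose_FDERIV[OF F[OF rho_pos[OF elim]] has_derivative_rho[of "fst y" "snd y", simplified prod.collapse]]
      unfolding differentiable_def o_def by blast
  qed
  then have defined: "?defined \<longleftrightarrow> has_div_at V (z, \<sigma>)"
    by (simp add: L_defined_at_def V_def)
  have G': "(G has_real_derivative G') (at r)"
  proof -
    have "F' r \<noteq> 0 \<or> 0 \<le> p - 2"
      using nondeg by (cases "p < 2") (auto simp: r_def)
    from DERIV_chain2[where g = F', OF DERIV_rpow_abs_mult[OF this] F'[folded r_def]]
    have "((\<lambda>s. rpow \<bar>F' s\<bar> (p - 2) * F' s) has_real_derivative (p - 2 + 1) * D * F2) (at r)"
      unfolding D_def .
    from DERIV_mult[OF this has_real_derivative_powr[OF r]] show ?thesis
      unfolding G_def by (rule DERIV_cong) (simp add: G'_def D_def algebra_simps)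
  qed
  have G_cont: "isCont (\<lambda>y. G (?\<rho> y)) (z, \<sigma>)"
    by (rule isCont_o2[OF has_derivative_continuous[OF has_derivative_rho[OF nz]] DERIV_isCont[OF G'[unfolded r_def]]])
  have "?defined \<and> ?formula"
  proof (cases "z = 0")
    case True
    have "((\<lambda>y. dual_norm \<Phi> (fst y)) \<longlongrightarrow> 0) (at (z, \<sigma>))"
      using isCont_o2[OF isCont_fst[OF continuous_ident] isCont_dual_norm[OF \<Phi>], of "(z, \<sigma>)"]
        dual_norm_zero[OF \<Phi>] True
      by (simp add: isCont_def)
    then have "((\<lambda>y. dual_norm \<Phi> (fst y) powr (\<alpha> * p)) \<longlongrightarrow> 0) (at (z, \<sigma>))"
      using \<alpha> p by (intro tendsto_zero_powrI[OF _ tendsto_const]) (auto simp: dual_norm_nonneg[OF \<Phi>])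
    then have "isCont (\<lambda>y. dual_norm \<Phi> (fst y) powr (\<alpha> * p)) (z, \<sigma>)"
      using True dual_norm_zero[OF \<Phi>] by (simp add: isCont_def)
    from isCont_mult[OF G_cont this] have cont: "isCont h (0, \<sigma>)"
      using True by (simp add: h_def)
    have zero: "h (0, \<tau>) = 0" for \<tau>
      by (simp add: h_def dual_norm_zero[OF \<Phi>])
    have "has_div_at V (z, \<sigma>)" "diverg V (z, \<sigma>) = 0"
      using divergence_scaled_dilation_field_degenerate[OF V[unfolded True] cont zero] True by simp_all
    then show ?thesis
      using defined True by (simp add: L_op_def dual_norm_zero[OF \<Phi>] flip: V_def)
  next
    case False
    define P where "P = dual_norm \<Phi> z"
    have P: "0 < P" using dual_norm_pos[OF \<Phi> False] by (simp add: P_def)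
    let ?D\<rho> = "\<lambda>h. r powr (- (2 * \<alpha> + 1)) * (P powr (2 * \<alpha> + 1) * (fst h \<bullet> polar \<Phi> z)
        + 4 * (\<alpha> + 1) * dual_norm \<Psi> \<sigma> * (snd h \<bullet> polar \<Psi> \<sigma>))"
    let ?h' = "\<lambda>v. G r * ((fst v \<bullet> polar \<Phi> z) * (\<alpha> * p * P powr (\<alpha> * p - 1))) + ?D\<rho> v * G' * P powr (\<alpha> * p)"
    have "((\<lambda>y. G (?\<rho> y)) has_derivative (\<lambda>v. ?D\<rho> v * G')) (at (z, \<sigma>))"
      using DERIV_compose_FDERIV[OF G'[unfolded r_def] has_derivative_rho[OF nz]] by (simp add: r_def P_def)
    moreover have "((\<lambda>y. dual_norm \<Phi> (fst y) powr (\<alpha> * p)) has_derivative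
        (\<lambda>v. (fst v \<bullet> polar \<Phi> z) * (\<alpha> * p * P powr (\<alpha> * p - 1)))) (at (z, \<sigma>))"
    proof -
      have "(dual_norm \<Phi> has_derivative (\<lambda>v. v \<bullet> polar \<Phi> z)) (at (fst (z, \<sigma>)))"
        using GDERIV_dual_norm[OF \<Phi> False] by (simp add: gderiv_def)
      then have "((\<lambda>y. dual_norm \<Phi> (fst y)) has_derivative (\<lambda>v. fst v \<bullet> polar \<Phi> z)) (at (z, \<sigma>))"
        by (rule has_derivative_compose[OF has_derivative_fst[OF has_derivative_ident]])
      moreover have "((\<lambda>s. s powr (\<alpha> * p)) has_real_derivative \<alpha> * p * P powr (\<alpha> * p - 1))
          (at (dual_norm \<Phi> (fst (z, \<sigma>))))"
        using has_real_derivative_powr[OF P] by (simp add: P_def)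
      ultimately show ?thesis
        using DERIV_compose_FDERIV[where f = "\<lambda>s. s powr (\<alpha> * p)" and g = "\<lambda>y. dual_norm \<Phi> (fst y)"] by blast
    qed
    ultimately have "(h has_derivative ?h') (at (z, \<sigma>))"
      unfolding h_def by (rule has_derivative_eq_rhs[OF has_derivative_mult]) (simp add: r_def P_def)
    note div = divergence_scaled_dilation_field[OF V this]
    have euler_P: "z \<bullet> polar \<Phi> z = P" and euler_R: "\<sigma> \<bullet> polar \<Psi> \<sigma> = dual_norm \<Psi> \<sigma>"
      using polar_attains[OF \<Phi>] polar_attains[OF \<Psi>] by (simp_all add: P_def)
    \<comment> \<open>Euler's identity \<open>X\<rho> = \<rho>\<close>: the weight \<open>\<alpha> + 1\<close> of \<open>\<sigma>\<close> in \<open>X\<close> restores the sum under the root in \<open>\<rho>\<close>.\<close>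
    have euler_\<rho>: "?D\<rho> (dilation_field (\<alpha> + 1) (z, \<sigma>)) = r"
    proof -
      have "?D\<rho> (dilation_field (\<alpha> + 1) (z, \<sigma>))
          = r powr (- (2 * \<alpha> + 1)) * (P powr (2 * \<alpha> + 1) * P + 4 * (\<alpha> + 1)\<^sup>2 * (dual_norm \<Psi> \<sigma>)\<^sup>2)"
        by (simp add: dilation_field_def euler_P euler_R power2_eq_square algebra_simps)
      also have "P powr (2 * \<alpha> + 1) * P = P powr (2 * (\<alpha> + 1))"
        using P powr_add[of P "2 * \<alpha> + 1" 1] by (simp add: algebra_simps)
      also have "P powr (2 * (\<alpha> + 1)) + 4 * (\<alpha> + 1)\<^sup>2 * (dual_norm \<Psi> \<sigma>)\<^sup>2 = r powr (2 * (\<alpha> + 1))"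
        using rho_powr[OF nz] by (simp add: r_def P_def)
      also have "r powr (- (2 * \<alpha> + 1)) * r powr (2 * (\<alpha> + 1)) = r"
        using r by (simp flip: powr_add)
      finally show ?thesis .
    qed
    have "diverg V (z, \<sigma>) = G r * (P * (\<alpha> * p * P powr (\<alpha> * p - 1))) + r * G' * P powr (\<alpha> * p)
        + G r * P powr (\<alpha> * p) * Q"
      unfolding div(2) euler_\<rho> by (simp add: dilation_field_def euler_P h_def Q flip: r_def P_def)
    also have "\<dots> = (p - 1) * D * (F2 + (Q - 1) / (p - 1) * (F' r / r)) * (P / r) powr (\<alpha> * p)"
    proof -
      define A where "A = r powr (- (\<alpha> * p))"
      define B where "B = P powr (\<alpha> * p)"
      have r_powers: "r powr (- (\<alpha> * p + 1)) = A / r" "r powr (- (\<alpha> * p + 1) - 1) = A / r / r"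
        using r powr_diff[of r "- (\<alpha> * p)" 1] powr_diff[of r "- (\<alpha> * p) - 1" 1] by (simp_all add: A_def)
      have euler: "P * (\<alpha> * p * P powr (\<alpha> * p - 1)) = \<alpha> * p * B"
        using P by (simp add: powr_diff B_def)
      have quotient: "(P / r) powr (\<alpha> * p) = B * A"
        using P r by (simp add: A_def B_def powr_divide powr_minus_divide)
      have "D * F' r * (A / r) * (\<alpha> * p * B)
            + r * ((p - 1) * D * F2 * (A / r) - (\<alpha> * p + 1) * (A / r / r) * (D * F' r)) * B
            + D * F' r * (A / r) * B * Q
          = (p - 1) * D * (F2 + (Q - 1) / (p - 1) * (F' r / r)) * (B * A)"
        using p r by (simp add: field_simps)
      then show ?thesis
        unfolding G_def G'_def D_def[symmetric] r_powers euler quotient B_def[symmetric] .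
    qed
    finally show ?thesis
      using defined div(1) by (simp add: L_op_def P_def D_def flip: V_def)
  qed
  then show ?defined ?formula by auto
qed

end

section \<open>The radial formula and the fundamental solution\<close>
lemma C2_on_deriv:
  fixes F :: "real \<Rightarrow> real"
  assumes "C2_on S F" "open S" "r \<in> S"
  shows "(F has_real_derivative deriv F r) (at r)"
    and "(deriv F has_real_derivative deriv (deriv F) r) (at r)"
proof -
  obtain f' :: "real \<Rightarrow> real \<Rightarrow>\<^sub>L real" and f'' :: "real \<Rightarrow> real \<Rightarrow>\<^sub>L (real \<Rightarrow>\<^sub>L real)" where
    f': "\<And>x. x \<in> S \<Longrightarrow> (F has_derivative blinfun_apply (f' x)) (at x)"
    and f'': "\<And>x. x \<in> S \<Longrightarrow> (f' has_derivative blinfun_apply (f'' x)) (at x)"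
    using assms(1) unfolding C2_on_def by blast
  have F: "(F has_real_derivative f' x 1) (at x)" if "x \<in> S" for x
  proof -
    have "blinfun_apply (f' x) h = f' x 1 * h" for h
      using blinfun.scaleR_right[of "f' x" h 1] by simp
    then show ?thesis
      unfolding has_field_derivative_def by (rule has_derivative_eq_rhs[OF f'[OF that] ext])
  qed
  then have eq: "deriv F x = f' x 1" if "x \<in> S" for x
    using that by (simp add: DERIV_imp_deriv)
  show "(F has_real_derivative deriv F r) (at r)"
    using F eq assms(3) by simp
  have der: "((\<lambda>x. f' x 1) has_derivative (\<lambda>h. f'' r h 1)) (at r)"
    by (rule bounded_linear.has_derivative[OF blinfun.bounded_linear_left f''[OF assms(3)]])
  have "blinfun_apply (f'' r h) 1 = f'' r 1 1 * h" for h
    using blinfun.scaleR_right[of "f'' r" h 1] by (simp add: blinfun.scaleR_left)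
  then have "((\<lambda>x. f' x 1) has_real_derivative f'' r 1 1) (at r)"
    unfolding has_field_derivative_def by (rule has_derivative_eq_rhs[OF der ext])
  then have "(deriv F has_real_derivative f'' r 1 1) (at r)"
    by (rule has_field_derivative_transform_within_open[OF _ assms(2,3)]) (simp add: eq)
  then show "(deriv F has_real_derivative deriv (deriv F) r) (at r)"
    by (simp add: DERIV_imp_deriv)
qed

theorem theorem1p1:
  fixes \<Phi> :: "real ^ 'm \<Rightarrow> real" and \<Psi> :: "real ^ 'k \<Rightarrow> real"
    and \<alpha> p Q :: real
  assumes "minkowski_norm \<Phi>" and "C2_on (UNIV - {0}) \<Phi>"
    and "minkowski_norm \<Psi>" and "C2_on (UNIV - {0}) \<Psi>"
    and "\<alpha> > 0" and "p > 1"
    and Q: "Q = real CARD('m) + (\<alpha> + 1) * real CARD('k)"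
  shows "(\<forall>F :: real \<Rightarrow> real. C2_on {0<..} F \<longrightarrow>
            (\<forall>z \<sigma>. (z, \<sigma>) \<noteq> 0 \<longrightarrow>
              (let r = rho \<alpha> \<Phi> \<Psi> (z, \<sigma>) in
               (p < 2 \<longrightarrow> deriv F r \<noteq> 0) \<longrightarrow>
               L_defined_at \<alpha> p \<Phi> \<Psi> (F \<circ> rho \<alpha> \<Phi> \<Psi>) (z, \<sigma>) \<and>
               L_op \<alpha> p \<Phi> \<Psi> (F \<circ> rho \<alpha> \<Phi> \<Psi>) (z, \<sigma>) =
                 (p - 1) * rpow \<bar>deriv F r\<bar> (p - 2) *
                 (deriv (deriv F) r + (Q - 1) / (p - 1) * (deriv F r / r)) *
                 (dual_norm \<Phi> z / r) powr (\<alpha> * p)))) \<and>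
         (let u = (\<lambda>x. if p \<noteq> Q then rho \<alpha> \<Phi> \<Psi> x powr (- ((Q - p) / (p - 1)))
                       else ln (rho \<alpha> \<Phi> \<Psi> x)) in
          \<forall>x. x \<noteq> 0 \<longrightarrow> L_defined_at \<alpha> p \<Phi> \<Psi> u x \<and> L_op \<alpha> p \<Phi> \<Psi> u x = 0)"
proof -
  note radial = L_of_radial_function[OF \<open>minkowski_norm \<Phi>\<close> \<open>minkowski_norm \<Psi>\<close> \<open>\<alpha> > 0\<close> \<open>p > 1\<close>]
  note \<rho>_pos = rho_pos[OF \<open>minkowski_norm \<Phi>\<close> \<open>minkowski_norm \<Psi>\<close> \<open>\<alpha> > 0\<close>]
  have Q': "Q = real DIM(real ^ 'm) + (\<alpha> + 1) * real DIM(real ^ 'k)"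
    using Q by simp
  show ?thesis
    unfolding Let_def
  proof (intro conjI allI impI)
    fix F :: "real \<Rightarrow> real" and z :: "real ^ 'm" and \<sigma> :: "real ^ 'k"
    assume F: "C2_on {0<..} F" and nz: "(z, \<sigma>) \<noteq> 0"
      and nondeg: "p < 2 \<longrightarrow> deriv F (rho \<alpha> \<Phi> \<Psi> (z, \<sigma>)) \<noteq> 0"
    note dF = C2_on_deriv[OF F open_greaterThan, simplified greaterThan_iff]
    note this_radial = radial[OF nz dF(1) dF(2)[OF \<rho>_pos[OF nz]] mp[OF nondeg] Q']
    show "L_defined_at \<alpha> p \<Phi> \<Psi> (F \<circ> rho \<alpha> \<Phi> \<Psi>) (z, \<sigma>)"
      by (rule this_radial(1))
    show "L_op \<alpha> p \<Phi> \<Psi> (F \<circ> rho \<alpha> \<Phi> \<Psi>) (z, \<sigma>) =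
        (p - 1) * rpow \<bar>deriv F (rho \<alpha> \<Phi> \<Psi> (z, \<sigma>))\<bar> (p - 2) *
        (deriv (deriv F) (rho \<alpha> \<Phi> \<Psi> (z, \<sigma>))
          + (Q - 1) / (p - 1) * (deriv F (rho \<alpha> \<Phi> \<Psi> (z, \<sigma>)) / rho \<alpha> \<Phi> \<Psi> (z, \<sigma>))) *
        (dual_norm \<Phi> z / rho \<alpha> \<Phi> \<Psi> (z, \<sigma>)) powr (\<alpha> * p)"
      by (rule this_radial(2))
  next
    let ?u = "\<lambda>x. if p \<noteq> Q then rho \<alpha> \<Phi> \<Psi> x powr (- ((Q - p) / (p - 1))) else ln (rho \<alpha> \<Phi> \<Psi> x)"
    fix x :: "(real ^ 'm) \<times> (real ^ 'k)"
    assume "x \<noteq> 0"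
    then obtain z \<sigma> where x: "x = (z, \<sigma>)" and nz: "(z, \<sigma>) \<noteq> 0" by (cases x) auto
    define r where "r = rho \<alpha> \<Phi> \<Psi> (z, \<sigma>)"
    have r: "0 < r" using \<rho>_pos[OF nz] by (simp add: r_def)
    have "L_defined_at \<alpha> p \<Phi> \<Psi> ?u x \<and> L_op \<alpha> p \<Phi> \<Psi> ?u x = 0"
    proof (cases "p = Q")
      case True
      have u: "?u = ln \<circ> rho \<alpha> \<Phi> \<Psi>" using True by auto
      have F: "(ln has_real_derivative inverse s) (at s)" if "0 < s" for s :: real
        using DERIV_ln[OF that] .
      have F': "(inverse has_real_derivative - (1 / r\<^sup>2)) (at (rho \<alpha> \<Phi> \<Psi> (z, \<sigma>)))"
        using DERIV_inverse[of r UNIV] r by (simp add: r_def power2_eq_square divide_inverse)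
      have nondeg: "inverse (rho \<alpha> \<Phi> \<Psi> (z, \<sigma>)) \<noteq> 0"
        using r by (simp add: r_def)
      show ?thesis
        unfolding u x using radial[OF nz F F' nondeg Q'] True r \<open>p > 1\<close>
        by (simp add: power2_eq_square divide_inverse flip: r_def)
    next
      case False
      define c where "c = - ((Q - p) / (p - 1))"
      have "c \<noteq> 0" using False \<open>p > 1\<close> by (simp add: c_def)
      have u: "?u = (\<lambda>s. s powr c) \<circ> rho \<alpha> \<Phi> \<Psi>" using False by (auto simp: c_def)
      have F: "((\<lambda>s. s powr c) has_real_derivative c * s powr (c - 1)) (at s)" if "0 < s" for s
        using has_real_derivative_powr[OF that] .
      have F': "((\<lambda>s. c * s powr (c - 1)) has_real_derivative c * ((c - 1) * r powr (c - 1 - 1)))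
          (at (rho \<alpha> \<Phi> \<Psi> (z, \<sigma>)))"
        unfolding r_def[symmetric] by (intro DERIV_cmult has_real_derivative_powr r)
      have nondeg: "c * rho \<alpha> \<Phi> \<Psi> (z, \<sigma>) powr (c - 1) \<noteq> 0"
        using r \<open>c \<noteq> 0\<close> by (simp add: r_def)
      have exponent: "r powr (c - 1 - 1) = r powr (c - 1) / r"
        using powr_diff[of r "c - 1" 1] r by simp
      \<comment> \<open>The exponent \<open>c\<close> is the one for which the two terms of the radial equation cancel.\<close>
      have coeff: "(Q - 1) / (p - 1) = - (c - 1)"
        using \<open>p > 1\<close> by (simp add: c_def field_simps)
      have "c * ((c - 1) * r powr (c - 1 - 1)) + (Q - 1) / (p - 1) * (c * r powr (c - 1) / r) = 0"
        unfolding exponent coeff using r by (simp add: field_simps)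
      then show ?thesis
        unfolding u x using radial[OF nz F F' nondeg Q'] by (simp flip: r_def)
    qed
    then show "L_defined_at \<alpha> p \<Phi> \<Psi> ?u x" "L_op \<alpha> p \<Phi> \<Psi> ?u x = 0" by auto
  qed
qed

end
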